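(* Let $X$ be a real Hilbert space, let $f\colon X\to\mathbb{R}$ be convex and continuous with $C=\{x\in X : f(x)\le 0\}\neq\varnothing$, let $s\colon X\to X$ be a selection of $\partial f$, and let $G\colon X\to X$ be the associated subgradient projector. Then $G$ is continuous everywhere (with respect to the norm topology) if and only if $f$ is Fréchet differentiable on $X\setminus C$.
   Context: A selection of the convex subdifferential $\partial f$ is a map $s\colon X\to X$ with $s(x)\in\partial f(x)$ for all $x\in X$. The subgradient projector associated with $f$ and $s$ is $G\colon X\to X$, $Gx = x-\frac{f(x)}{\|s(x)\|^2}s(x)$ if $f(x)>0$, and $Gx=x$ otherwise (well defined, since $C\ne\varnothing$ implies $0\notin\partial f(x)$ whenever $f(x)>0$). *)

theory Defs
  imports "HOL-Analysis.Analysis"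
begin

definition subdifferential :: "('a::real_inner \<Rightarrow> real) \<Rightarrow> 'a \<Rightarrow> 'a set" where
  "subdifferential f x = {u. \<forall>y. f x + inner u (y - x) \<le> f y}"

definition subdifferential_selection :: "('a::real_inner \<Rightarrow> 'a) \<Rightarrow> ('a \<Rightarrow> real) \<Rightarrow> bool" where
  "subdifferential_selection s f \<longleftrightarrow> (\<forall>x. s x \<in> subdifferential f x)"

(* When s selects from the subdifferential and f \<le> 0 somewhere, s x is nonzero wherever
   f x > 0, so the convention x / 0 = 0 never comes into play. *)
definition subgradient_projector ::
    "('a::real_inner \<Rightarrow> real) \<Rightarrow> ('a \<Rightarrow> 'a) \<Rightarrow> 'a \<Rightarrow> 'a" where
  "subgradient_projector f s x =
     (if f x > 0 then x - (f x / (norm (s x))\<^sup>2) *\<^sub>R s x else x)"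

end

theory Submission
  imports Defs
begin

text \<open>
  Both directions go through the norm continuity of \<open>s\<close> on the open set \<open>{f > 0}\<close>: there
  \<open>x - G x = (f x / \<parallel>s x\<parallel>\<^sup>2) s x\<close> and \<open>s x = (f x / \<parallel>x - G x\<parallel>\<^sup>2) (x - G x)\<close>, so \<open>G\<close> and \<open>s\<close> are
  continuous at the same points of this set. By the subgradient inequality, a selection of the
  subdifferential is continuous at a point exactly when \<open>f\<close> is differentiable there. At a point \<open>x\<close> with \<open>f x \<le> 0\<close> the projector is always continuous, because the
  subgradient inequality gives \<open>\<parallel>G y - y\<parallel> \<le> \<parallel>y - x\<parallel>\<close>.
\<close>

lemma subdifferential_selectionD:
  assumes "subdifferential_selection s f"
  shows "f x + inner (s x) (y - x) \<le> f y"
  using assms by (auto simp: subdifferential_selection_def subdifferential_def)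

text \<open>A zero subgradient would make \<open>x\<close> a global minimizer, against
  \<open>f z \<le> 0 < f x\<close>.\<close>

lemma subdifferential_selection_nonzero:
  assumes "subdifferential_selection s f" "f z \<le> 0" "f x > 0"
  shows "s x \<noteq> 0"
  using subdifferential_selectionD[OF assms(1), of x z] assms(2,3) by auto

text \<open>A subgradient \<open>u\<close> at \<open>x\<close> makes \<open>x\<close> a global
  minimizer of \<open>f y - inner u y\<close>, so the derivative of that difference vanishes at
  \<open>x\<close>.\<close>

lemma has_derivative_unique_subgradient:
  fixes f :: "'a::real_inner \<Rightarrow> real"
  assumes "(f has_derivative f') (at x)" and "u \<in> subdifferential f x"
  shows "f' = inner u"
proof -
  have "((\<lambda>y. f y - inner u y) has_derivative (\<lambda>h. f' h - inner u h)) (at x)"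
    by (intro has_derivative_diff assms(1) bounded_linear_imp_has_derivative
        bounded_linear_inner_right)
  moreover have "\<forall>y\<in>UNIV. f x - inner u x \<le> f y - inner u y"
    using assms(2) by (auto simp: subdifferential_def inner_diff_right algebra_simps)
  ultimately have "(\<lambda>h. f' h - inner u h) = (\<lambda>h. 0)"
    by (intro differential_zero_maxmin[of x UNIV "\<lambda>y. f y - inner u y"]) auto
  then show ?thesis
    by (metis eq_iff_diff_eq_0 ext)
qed

lemma isCont_subdifferential_selection:
  fixes f :: "'a::real_inner \<Rightarrow> real"
  assumes sel: "subdifferential_selection s f" and diff: "f differentiable (at x)"
  shows "isCont s x"
  unfolding continuous_at_eps_delta
proof (intro allI impI)
  fix e :: real assume "e > 0"
  obtain f' where f': "(f has_derivative f') (at x)"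
    using diff unfolding differentiable_def by blast
  have "f' = inner (s x)"
    using has_derivative_unique_subgradient[OF f'] sel
    by (auto simp: subdifferential_selection_def)
  then obtain d where "d > 0"
    and d: "\<And>y. norm (y - x) < d \<Longrightarrow> \<bar>f y - f x - inner (s x) (y - x)\<bar> \<le> e / 4 * norm (y - x)"
    using f' \<open>e > 0\<close> unfolding has_derivative_at_alt real_norm_def
    by (meson divide_pos_pos zero_less_numeral)
  \<comment> \<open>With \<open>norm h = d / 2\<close>, the radius \<open>d / 4\<close> lets the
    displacement \<open>y - x\<close> absorb only half of the gain \<open>d / 2 * n\<close>, and the
    remainder bound contributes \<open>e * d / 8\<close>. What is left is
    \<open>n \<le> e / 2\<close>.\<close>
  have "norm (s y - s x) < e" if y: "norm (y - x) < d / 4" for y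
  proof (cases "s y = s x")
    case False
    define n where "n = norm (s y - s x)"
    have "n > 0" using False by (simp add: n_def)
    \<comment> \<open>test the subgradient inequality at \<open>y\<close> in the direction of \<open>s y - s x\<close> from \<open>x\<close>\<close>
    define h where "h = (d / 2 / n) *\<^sub>R (s y - s x)"
    have nh: "norm h = d / 2"
      using \<open>n > 0\<close> \<open>d > 0\<close> by (simp add: h_def n_def)
    have ih: "inner (s y - s x) h = d / 2 * n"
      using \<open>n > 0\<close> by (simp add: h_def n_def dot_square_norm power2_eq_square)
    have "f (x + h) \<le> f x + inner (s x) h + e / 4 * (d / 2)"
    proof -
      have "\<bar>f (x + h) - f x - inner (s x) h\<bar> \<le> e / 4 * (d / 2)"
        using d[of "x + h"] nh \<open>d > 0\<close> by simp
      then show ?thesis by linarith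
    qed
    moreover have "f y + inner (s y) (x + h - y) \<le> f (x + h)"
      by (rule subdifferential_selectionD[OF sel])
    moreover have "f x + inner (s x) (y - x) \<le> f y"
      by (rule subdifferential_selectionD[OF sel])
    \<comment> \<open>Chaining the three inequalities cancels every value of
      \<open>f\<close>.\<close>
    ultimately have "inner (s y - s x) h \<le> inner (s y - s x) (y - x) + e / 4 * (d / 2)"
      by (simp add: inner_simps)
    also have "inner (s y - s x) (y - x) \<le> n * norm (y - x)"
      unfolding n_def by (rule norm_cauchy_schwarz)
    also have "\<dots> \<le> n * (d / 4)"
      using y \<open>n > 0\<close> by (intro mult_left_mono) auto
    finally have "d / 4 * n \<le> d / 4 * (e / 2)"
      unfolding ih by (simp add: field_simps)
    then have "n \<le> e / 2"
      using \<open>d > 0\<close> by simp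
    then show ?thesis
      using \<open>e > 0\<close> by (simp add: n_def)
  qed (use \<open>e > 0\<close> in simp)
  then show "\<exists>d>0. \<forall>y. dist y x < d \<longrightarrow> dist (s y) (s x) < e"
    using \<open>d > 0\<close> unfolding dist_norm by (intro exI[of _ "d / 4"]) auto
qed

text \<open>The subgradient inequalities at \<open>x\<close> and at \<open>y\<close> squeeze the
  first-order remainder between \<open>0\<close> and \<open>inner (s y - s x) (y - x)\<close>, which
  is o(\<open>norm (y - x)\<close>) when \<open>s\<close> is continuous at \<open>x\<close>.\<close>

lemma has_derivative_subdifferential_selection:
  fixes f :: "'a::real_inner \<Rightarrow> real"
  assumes sel: "subdifferential_selection s f" and cont: "isCont s x"
  shows "(f has_derivative inner (s x)) (at x)"
  unfolding has_derivative_at_alt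
proof (intro conjI allI impI)
  fix e :: real assume "e > 0"
  then obtain d where "d > 0" and d: "\<And>y. norm (y - x) < d \<Longrightarrow> norm (s y - s x) < e"
    using cont unfolding continuous_at_eps_delta dist_norm by blast
  have "norm (f y - f x - inner (s x) (y - x)) \<le> e * norm (y - x)" if "norm (y - x) < d" for y
  proof -
    have "0 \<le> f y - f x - inner (s x) (y - x)"
      using subdifferential_selectionD[OF sel, of x y] by simp
    moreover have "f y - f x - inner (s x) (y - x) \<le> inner (s y - s x) (y - x)"
      using subdifferential_selectionD[OF sel, of y x] by (simp add: inner_simps)
    moreover have "\<dots> \<le> norm (s y - s x) * norm (y - x)"
      by (rule norm_cauchy_schwarz)
    moreover have "\<dots> \<le> e * norm (y - x)"
      using d[OF that] by (intro mult_right_mono) auto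
    ultimately show ?thesis by simp
  qed
  then show "\<exists>d>0. \<forall>y. norm (y - x) < d \<longrightarrow>
      norm (f y - f x - inner (s x) (y - x)) \<le> e * norm (y - x)"
    using \<open>d > 0\<close> by blast
qed (rule bounded_linear_inner_right)

text \<open>Where \<open>f y > 0\<close>, the projector moves \<open>y\<close> by
  \<open>f y / norm (s y)\<close>. This is at most the distance to any point \<open>x\<close> with
  \<open>f x \<le> 0\<close>, by the subgradient inequality at \<open>y\<close> and
  Cauchy-Schwarz.\<close>

lemma norm_subgradient_projector_diff_le:
  assumes sel: "subdifferential_selection s f" and "f x \<le> 0"
  shows "norm (subgradient_projector f s y - y) \<le> norm (y - x)"
proof (cases "f y > 0")
  case True
  have "s y \<noteq> 0"
    using subdifferential_selection_nonzero[OF sel assms(2) True] .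
  have "f y \<le> inner (s y) (y - x)"
    using subdifferential_selectionD[OF sel, of y x] assms(2) by (simp add: inner_simps)
  also have "\<dots> \<le> norm (s y) * norm (y - x)"
    by (rule norm_cauchy_schwarz)
  finally have "f y / norm (s y) \<le> norm (y - x)"
    using \<open>s y \<noteq> 0\<close> by (simp add: field_simps)
  then show ?thesis
    using True \<open>s y \<noteq> 0\<close> by (simp add: subgradient_projector_def power2_eq_square)
qed (simp add: subgradient_projector_def)

lemma isCont_subgradient_projector_nonpos:
  assumes "subdifferential_selection s f" "f x \<le> 0"
  shows "isCont (subgradient_projector f s) x"
  unfolding continuous_at_eps_delta
proof (intro allI impI)
  fix e :: real assume "e > 0"
  \<comment> \<open>The radius is \<open>e / 2\<close> because the image of \<open>y\<close> is
    within twice \<open>norm (y - x)\<close> of \<open>x\<close>.\<close>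
  have "norm (subgradient_projector f s y - x) < e" if "norm (y - x) < e / 2" for y
  proof -
    have "norm (subgradient_projector f s y - x)
        \<le> norm (subgradient_projector f s y - y) + norm (y - x)"
      using norm_triangle_ineq[of "subgradient_projector f s y - y" "y - x"] by simp
    with norm_subgradient_projector_diff_le[OF assms, of y] that show ?thesis by simp
  qed
  moreover have "subgradient_projector f s x = x"
    using assms(2) by (simp add: subgradient_projector_def)
  ultimately show "\<exists>d>0. \<forall>y. dist y x < d \<longrightarrow>
      dist (subgradient_projector f s y) (subgradient_projector f s x) < e"
    using \<open>e > 0\<close> unfolding dist_norm by (intro exI[of _ "e / 2"]) auto
qed

lemma isCont_subgradient_projector_iff:
  assumes contf: "continuous_on UNIV f" and nz: "\<And>y. f y > 0 \<Longrightarrow> s y \<noteq> 0" and x: "f x > 0"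
  shows "isCont (subgradient_projector f s) x \<longleftrightarrow> isCont s x"
proof
  let ?G = "subgradient_projector f s"
  have "open {y. f y > 0}"
    using contf by (intro open_Collect_less) auto
  \<comment> \<open>Continuity at \<open>x\<close> depends only on nearby values, so the formulas
    valid where \<open>f\<close> is positive suffice.\<close>
  then have ev: "\<forall>\<^sub>F y in nhds x. f y > 0"
    using x eventually_nhds by blast
  have fx: "isCont f x"
    using contf by (simp add: continuous_on_eq_continuous_at)
  have Gy: "?G y = y - (f y / (norm (s y))\<^sup>2) *\<^sub>R s y" if "f y > 0" for y
    using that by (simp add: subgradient_projector_def)
  \<comment> \<open>Since \<open>y - ?G y\<close> has norm \<open>f y / norm (s y)\<close>, the
    factor in front of it equals \<open>(norm (s y))\<^sup>2 / f y\<close>, the inverse of the one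
    in the projector.\<close>
  have sy: "(f y / (norm (y - ?G y))\<^sup>2) *\<^sub>R (y - ?G y) = s y" and ne: "y - ?G y \<noteq> 0"
    if "f y > 0" for y
    using that nz[OF that] by (simp_all add: Gy power2_eq_square)
  show "isCont ?G x" if "isCont s x"
  proof -
    have "isCont (\<lambda>y. y - (f y / (norm (s y))\<^sup>2) *\<^sub>R s y) x"
      using that fx nz[OF x] by (intro continuous_intros) auto
    moreover have "\<forall>\<^sub>F y in nhds x. ?G y = y - (f y / (norm (s y))\<^sup>2) *\<^sub>R s y"
      using ev by eventually_elim (rule Gy)
    ultimately show ?thesis
      by (simp add: isCont_cong)
  qed
  show "isCont s x" if "isCont ?G x"
  proof -
    have "isCont (\<lambda>y. (f y / (norm (y - ?G y))\<^sup>2) *\<^sub>R (y - ?G y)) x"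
      using that fx ne[OF x] by (intro continuous_intros) auto
    moreover have "\<forall>\<^sub>F y in nhds x. (f y / (norm (y - ?G y))\<^sup>2) *\<^sub>R (y - ?G y) = s y"
      using ev by eventually_elim (rule sy)
    ultimately show ?thesis
      by (simp add: isCont_cong)
  qed
qed

theorem corollary5p7:
  fixes f :: "'a::{real_inner, complete_space} \<Rightarrow> real" and s :: "'a \<Rightarrow> 'a"
  assumes "convex_on UNIV f"
    and "continuous_on UNIV f"
    and "{x. f x \<le> 0} \<noteq> {}"
    and "subdifferential_selection s f"
  shows "continuous_on UNIV (subgradient_projector f s) \<longleftrightarrow>
         (\<forall>x \<in> UNIV - {x. f x \<le> 0}. f differentiable (at x))"
proof -
  obtain z where "f z \<le> 0"
    using assms(3) by blast
  then have nz: "s y \<noteq> 0" if "f y > 0" for y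
    using subdifferential_selection_nonzero[OF assms(4)] that by blast
  have "isCont s x \<longleftrightarrow> f differentiable (at x)" for x
    using isCont_subdifferential_selection[OF assms(4)]
      has_derivative_subdifferential_selection[OF assms(4)]
    unfolding differentiable_def by blast
  then have "isCont (subgradient_projector f s) x \<longleftrightarrow> f differentiable (at x)" if "f x > 0" for x
    using isCont_subgradient_projector_iff[OF assms(2) nz that] by simp
  \<comment> \<open>Points with \<open>f x \<le> 0\<close> never obstruct continuity, so only those
    with \<open>f x > 0\<close> decide it.\<close>
  then show ?thesis
    using isCont_subgradient_projector_nonpos[OF assms(4)]
    unfolding continuous_on_eq_continuous_at[OF open_UNIV]
    by (metis DiffD2 DiffI UNIV_I mem_Collect_eq not_le)
qed

end
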